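(* Let $0<\rho\le\frac13$ and $\mathcal I_\rho=[-\rho,1+\rho]$. The quasi-interpolation operators $\Pi_0$ and $\Pi_1$ (defined in the context) are well-defined on $L^2\Lambda^0(\mathcal I_\rho)$ and $L^2\Lambda^1(\mathcal I_\rho)$, respectively, and satisfy $$\|\Pi_0u\|_{L^2\Lambda^0(\mathcal I_\rho)}\le C_{\Pi_0}\|u\|_{L^2\Lambda^0(\mathcal I_\rho)}\qquad\forall u\in L^2\Lambda^0(\mathcal I_\rho),$$ $$\|\Pi_1v\|_{L^2\Lambda^1(\mathcal I_\rho)}\le C_{\Pi_1}\|v\|_{L^2\Lambda^1(\mathcal I_\rho)}\qquad\forall v\in L^2\Lambda^1(\mathcal I_\rho),$$ where $C_{\Pi_0},C_{\Pi_1}$ are positive constants depending on $\rho$ but independent of $u$ and $v$.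
   Context: On an interval, $0$-forms are functions and $1$-forms $v\,dx$ are identified with their coefficient $v$; $L^2\Lambda^k(\mathcal I_\rho)=L^2(\mathcal I_\rho)$ for $k=0,1$. Cut-off functions: $\eta(x)=C\exp\bigl(\frac1{|x|^2-1}\bigr)$ for $|x|<1$, $\eta(x)=0$ for $|x|\ge1$, with $C$ chosen so that $\int_{\mathbb R}\eta=1$; $\eta_l(x)=\frac1\rho\eta(\frac x\rho)$, $\eta_r(x)=\frac1\rho\eta(\frac{x-1}\rho)$; $B_l$ and $B_r$ are the intervals of radius $\rho$ centered at $0$ and $1$. For $y_l\in B_l$, $y_r\in B_r$, perturbed node functionals: for $u\in C^1(\mathcal I_\rho)$, $\widetilde{\mathcal N^0_1}(u)=u'(y_l)$, $\widetilde{\mathcal N^0_2}(u)=u'(y_r)$, $\widetilde{\mathcal N^0_3}(u)=u(y_r)-u(y_l)$, $\widetilde{\mathcal N^0_4}(u)=u(y_r)+u(y_l)$; for $v\in C^0(\mathcal I_\rho)$, $\widetilde{\mathcal N^1_1}(v)=v(y_l)$, $\widetilde{\mathcal N^1_2}(v)=v(y_r)$, $\widetilde{\mathcal N^1_3}(v)=\int_{y_l}^{y_r}v(x)\,dx$. Weighted node functionals: $\overline{\mathcal N^k_i}(u)=\int_{B_l}\int_{B_r}\eta_l(\xi_l)\eta_r(\xi_r)\,\widetilde{\mathcal N^k_i}(u)\,d\xi_r\,d\xi_l$, where $\widetilde{\mathcal N^k_i}$ is taken with $y_l=\xi_l$, $y_r=\xi_r$. Basis functions: $\varphi^0_1=x-2x^2+x^3$,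 $\varphi^0_2=-x^2+x^3$, $\varphi^0_3=-\frac12+3x^2-2x^3$, $\varphi^0_4=\frac12$; $\varphi^1_1=1-4x+3x^2$, $\varphi^1_2=-2x+3x^2$, $\varphi^1_3=6x-6x^2$. Quasi-interpolation operators: $\Pi_0u=\sum_{i=1}^4\overline{\mathcal N^0_i}(u)\varphi^0_i$ for $u\in C^1(\mathcal I_\rho)$ and $\Pi_1v=\sum_{i=1}^3\overline{\mathcal N^1_i}(v)\varphi^1_i$ for $v\in C^0(\mathcal I_\rho)$. Their values are polynomials, regarded as functions on $\mathcal I_\rho$. On $L^2$, the functionals $\overline{\mathcal N^k_i}$, and hence $\Pi_0,\Pi_1$, are understood as the continuous extensions from the dense subspaces $C^1(\mathcal I_\rho)$, resp. $C^0(\mathcal I_\rho)$; "well-defined on $L^2$" means that these extensions exist. *)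

theory Defs
  imports "HOL-Analysis.Analysis"
begin

definition I_rho :: "real \<Rightarrow> real set" where
  "I_rho \<rho> = {-\<rho>..1 + \<rho>}"

(* Functions on I_rho are represented by total functions on the reals; every notion below depends
   only on their values on I_rho.  The elements of L2 are functions, not classes modulo
   almost-everywhere equality, so L2_norm is a seminorm. *)

definition L2 :: "real \<Rightarrow> (real \<Rightarrow> real) set" where
  "L2 \<rho> = {u. u \<in> borel_measurable (lebesgue_on (I_rho \<rho>)) \<and>
              integrable (lebesgue_on (I_rho \<rho>)) (\<lambda>x. (u x)\<^sup>2)}"

definition L2_norm :: "real \<Rightarrow> (real \<Rightarrow> real) \<Rightarrow> real" where
  "L2_norm \<rho> u = sqrt (LINT x|lebesgue_on (I_rho \<rho>). (u x)\<^sup>2)"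

definition C0 :: "real \<Rightarrow> (real \<Rightarrow> real) set" where
  "C0 \<rho> = {v. continuous_on (I_rho \<rho>) v}"

(* One-sided derivatives at the endpoints of I_rho. *)
definition C1 :: "real \<Rightarrow> (real \<Rightarrow> real) set" where
  "C1 \<rho> = {u. \<exists>u'. continuous_on (I_rho \<rho>) u' \<and>
              (\<forall>x\<in>I_rho \<rho>. (u has_real_derivative u' x) (at x within I_rho \<rho>))}"

definition eta_with :: "real \<Rightarrow> real \<Rightarrow> real" where
  "eta_with C x = (if \<bar>x\<bar> < 1 then C * exp (1 / (\<bar>x\<bar>\<^sup>2 - 1)) else 0)"

definition eta :: "real \<Rightarrow> real" where
  "eta = eta_with (THE C. (LINT x|lborel. eta_with C x) = 1)"

definition eta_l :: "real \<Rightarrow> real \<Rightarrow> real" where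
  "eta_l \<rho> x = 1 / \<rho> * eta (x / \<rho>)"

definition eta_r :: "real \<Rightarrow> real \<Rightarrow> real" where
  "eta_r \<rho> x = 1 / \<rho> * eta ((x - 1) / \<rho>)"

(* The intervals are open, hence contained in the interior of I_rho, and deriv in node0 is the
   derivative of u as a function on I_rho.  Closed intervals would give the same integrals. *)
definition B_l :: "real \<Rightarrow> real set" where
  "B_l \<rho> = ball 0 \<rho>"

definition B_r :: "real \<Rightarrow> real set" where
  "B_r \<rho> = ball 1 \<rho>"

(* Indices start at 1; the value 0 at any other index is arbitrary. *)

definition node0 :: "real \<Rightarrow> real \<Rightarrow> nat \<Rightarrow> (real \<Rightarrow> real) \<Rightarrow> real" where
  "node0 yl yr i u =
     (if i = 1 then deriv u yl
      else if i = 2 then deriv u yr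
      else if i = 3 then u yr - u yl
      else if i = 4 then u yr + u yl
      else 0)"

definition node1 :: "real \<Rightarrow> real \<Rightarrow> nat \<Rightarrow> (real \<Rightarrow> real) \<Rightarrow> real" where
  "node1 yl yr i v =
     (if i = 1 then v yl
      else if i = 2 then v yr
      else if i = 3 then (LBINT x=yl..yr. v x)
      else 0)"

definition wnode0 :: "real \<Rightarrow> nat \<Rightarrow> (real \<Rightarrow> real) \<Rightarrow> real" where
  "wnode0 \<rho> i u =
     (LBINT \<xi>l:B_l \<rho>. (LBINT \<xi>r:B_r \<rho>. eta_l \<rho> \<xi>l * eta_r \<rho> \<xi>r * node0 \<xi>l \<xi>r i u))"

definition wnode1 :: "real \<Rightarrow> nat \<Rightarrow> (real \<Rightarrow> real) \<Rightarrow> real" where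
  "wnode1 \<rho> i v =
     (LBINT \<xi>l:B_l \<rho>. (LBINT \<xi>r:B_r \<rho>. eta_l \<rho> \<xi>l * eta_r \<rho> \<xi>r * node1 \<xi>l \<xi>r i v))"

definition phi0 :: "nat \<Rightarrow> real \<Rightarrow> real" where
  "phi0 i x =
     (if i = 1 then x - 2 * x^2 + x^3
      else if i = 2 then - (x^2) + x^3
      else if i = 3 then - 1 / 2 + 3 * x^2 - 2 * x^3
      else if i = 4 then 1 / 2
      else 0)"

definition phi1 :: "nat \<Rightarrow> real \<Rightarrow> real" where
  "phi1 i x =
     (if i = 1 then 1 - 4 * x + 3 * x^2
      else if i = 2 then - 2 * x + 3 * x^2
      else if i = 3 then 6 * x - 6 * x^2
      else 0)"

definition L2_continuous :: "real \<Rightarrow> ((real \<Rightarrow> real) \<Rightarrow> real) \<Rightarrow> bool" where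
  "L2_continuous \<rho> G \<longleftrightarrow>
     (\<forall>u\<in>L2 \<rho>. \<forall>e>0. \<exists>d>0. \<forall>v\<in>L2 \<rho>.
        L2_norm \<rho> (\<lambda>x. v x - u x) < d \<longrightarrow> \<bar>G v - G u\<bar> < e)"

(* Functionals on L2 are made total by the value undefined outside L2 (extensional), so that a
   continuous extension from a dense subspace D is unique as a HOL function. *)
definition is_L2_extension ::
  "real \<Rightarrow> (real \<Rightarrow> real) set \<Rightarrow> ((real \<Rightarrow> real) \<Rightarrow> real) \<Rightarrow> ((real \<Rightarrow> real) \<Rightarrow> real) \<Rightarrow> bool" where
  "is_L2_extension \<rho> D F G \<longleftrightarrow>
     G \<in> extensional (L2 \<rho>) \<and> L2_continuous \<rho> G \<and> (\<forall>u\<in>D. G u = F u)"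

definition L2_extension ::
  "real \<Rightarrow> (real \<Rightarrow> real) set \<Rightarrow> ((real \<Rightarrow> real) \<Rightarrow> real) \<Rightarrow> (real \<Rightarrow> real) \<Rightarrow> real" where
  "L2_extension \<rho> D F = (THE G. is_L2_extension \<rho> D F G)"

(* The quasi-interpolation operators on L2, built from the extended functionals.  On C1, resp. C0,
   the extensions agree with wnode0, resp. wnode1. *)

definition Pi0 :: "real \<Rightarrow> (real \<Rightarrow> real) \<Rightarrow> real \<Rightarrow> real" where
  "Pi0 \<rho> u x = (\<Sum>i=1..4. L2_extension \<rho> (C1 \<rho>) (wnode0 \<rho> i) u * phi0 i x)"

definition Pi1 :: "real \<Rightarrow> (real \<Rightarrow> real) \<Rightarrow> real \<Rightarrow> real" where
  "Pi1 \<rho> v x = (\<Sum>i=1..3. L2_extension \<rho> (C0 \<rho>) (wnode1 \<rho> i) v * phi1 i x)"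

end

theory Submission
  imports Defs
begin

text \<open>Each weighted node functional is integration against a fixed continuous weight \<open>w\<close>.
  The weighted point values are so by definition; for \<open>\<integral> \<eta>\<^sub>l u'\<close> and \<open>\<integral> \<eta>\<^sub>r u'\<close> the derivative is moved to
  the cut-off function, which is continuously differentiable and vanishes at the ends of the interval;
  for the weighted integral of \<open>v\<close> one writes the inner integral as \<open>V y\<^sub>r - V y\<^sub>l\<close> with a primitive \<open>V\<close>
  of \<open>v\<close> and integrates by parts in the other direction. Hence the functionals are bounded by the \<open>L\<^sup>2\<close>
  norm, and the extensions are unique because \<open>C\<^sup>1\<close> is dense in \<open>L\<^sup>2\<close> (truncation, approximation of
  measurable functions by continuous ones almost everywhere, Weierstrass).\<close>

subsection \<open>Density of smooth functions in L2\<close>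

lemma I_rho_lebesgue [simp]: "I_rho \<rho> \<in> sets lebesgue"
  by (simp add: I_rho_def)

lemma space_I_rho [simp]: "space (lebesgue_on (I_rho \<rho>)) = I_rho \<rho>"
  by (simp add: space_restrict_space)

lemma C0_zero: "(\<lambda>x. 0) \<in> C0 \<rho>"
  by (simp add: C0_def)

lemma C0_minus: "u \<in> C0 \<rho> \<Longrightarrow> (\<lambda>x. - u x) \<in> C0 \<rho>"
  by (simp add: C0_def continuous_on_minus)

lemma C0_measurable: "u \<in> C0 \<rho> \<Longrightarrow> u \<in> borel_measurable (lebesgue_on (I_rho \<rho>))"
  by (simp add: C0_def continuous_imp_measurable_on_sets_lebesgue)

lemma C0_integrable: "u \<in> C0 \<rho> \<Longrightarrow> integrable (lebesgue_on (I_rho \<rho>)) u"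
  by (simp add: C0_def I_rho_def continuous_imp_integrable_real)

lemma C0_bounded:
  assumes "u \<in> C0 \<rho>"
  obtains K where "K > 0" "\<And>x. x \<in> I_rho \<rho> \<Longrightarrow> \<bar>u x\<bar> \<le> K"
proof -
  have "compact (u ` I_rho \<rho>)"
    using assms by (auto simp: C0_def I_rho_def intro: compact_continuous_image)
  then have "bounded (u ` I_rho \<rho>)"
    by (rule compact_imp_bounded)
  then show thesis
    unfolding bounded_pos using that by auto
qed

lemma C0_subset_L2: "C0 \<rho> \<subseteq> L2 \<rho>"
proof
  fix u assume "u \<in> C0 \<rho>"
  moreover from this have "(\<lambda>x. (u x)\<^sup>2) \<in> C0 \<rho>"
    by (auto simp: C0_def intro: continuous_intros)
  ultimately show "u \<in> L2 \<rho>"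
    by (simp add: L2_def C0_measurable C0_integrable)
qed

lemma C1_subset_C0: "C1 \<rho> \<subseteq> C0 \<rho>"
  unfolding C0_def C1_def by (auto intro: DERIV_continuous_on)

lemma L2_bounded_measurable:
  assumes "u \<in> borel_measurable (lebesgue_on (I_rho \<rho>))" "\<And>x. x \<in> I_rho \<rho> \<Longrightarrow> \<bar>u x\<bar> \<le> K"
  shows "u \<in> L2 \<rho>"
proof -
  have "integrable (lebesgue_on (I_rho \<rho>)) (\<lambda>x. (u x)\<^sup>2)"
  proof (rule Bochner_Integration.integrable_bound)
    show "integrable (lebesgue_on (I_rho \<rho>)) (\<lambda>x. K\<^sup>2)"
      by (intro C0_integrable) (simp add: C0_def)
    show "AE x in lebesgue_on (I_rho \<rho>). norm ((u x)\<^sup>2) \<le> norm (K\<^sup>2)"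
    proof (rule AE_I2)
      fix x assume "x \<in> space (lebesgue_on (I_rho \<rho>))"
      then have "\<bar>u x\<bar> \<le> \<bar>K\<bar>"
        using assms(2)[of x] by simp
      then show "norm ((u x)\<^sup>2) \<le> norm (K\<^sup>2)"
        by (simp add: abs_le_square_iff)
    qed
  qed (use assms(1) in simp)
  with assms(1) show ?thesis
    by (simp add: L2_def)
qed

lemma L2_diff:
  assumes "u \<in> L2 \<rho>" "v \<in> L2 \<rho>"
  shows "(\<lambda>x. u x - v x) \<in> L2 \<rho>"
proof -
  have [measurable]: "u \<in> borel_measurable (lebesgue_on (I_rho \<rho>))"
    "v \<in> borel_measurable (lebesgue_on (I_rho \<rho>))"
    using assms by (auto simp: L2_def)
  have "integrable (lebesgue_on (I_rho \<rho>)) (\<lambda>x. (u x - v x)\<^sup>2)"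
  proof (rule Bochner_Integration.integrable_bound)
    show "integrable (lebesgue_on (I_rho \<rho>)) (\<lambda>x. 2 * (u x)\<^sup>2 + 2 * (v x)\<^sup>2)"
      using assms by (auto simp: L2_def)
    have "(u x - v x)\<^sup>2 \<le> 2 * (u x)\<^sup>2 + 2 * (v x)\<^sup>2" for x
      using zero_le_power2[of "u x + v x"] by (simp add: power2_eq_square algebra_simps)
    then show "AE x in lebesgue_on (I_rho \<rho>). norm ((u x - v x)\<^sup>2) \<le> norm (2 * (u x)\<^sup>2 + 2 * (v x)\<^sup>2)"
      by simp
  qed measurable
  then show ?thesis
    by (simp add: L2_def)
qed

lemma L2_norm_nonneg: "L2_norm \<rho> u \<ge> 0"
  by (simp add: L2_norm_def)

lemma L2_norm_power2: "(L2_norm \<rho> u)\<^sup>2 = (LINT x|lebesgue_on (I_rho \<rho>). (u x)\<^sup>2)"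
  by (simp add: L2_norm_def)

lemma L2_norm_le_sup:
  assumes "\<And>x. x \<in> I_rho \<rho> \<Longrightarrow> \<bar>u x\<bar> \<le> K" "K \<ge> 0" "u \<in> L2 \<rho>"
  shows "L2_norm \<rho> u \<le> K * sqrt (measure lebesgue (I_rho \<rho>))"
proof -
  have "(L2_norm \<rho> u)\<^sup>2 \<le> (LINT x|lebesgue_on (I_rho \<rho>). K\<^sup>2)"
    unfolding L2_norm_power2
  proof (rule integral_mono)
    show "integrable (lebesgue_on (I_rho \<rho>)) (\<lambda>x. K\<^sup>2)"
      by (intro C0_integrable) (simp add: C0_def)
    show "(u x)\<^sup>2 \<le> K\<^sup>2" if "x \<in> space (lebesgue_on (I_rho \<rho>))" for x
      using assms(1)[of x] assms(2) that by (simp add: abs_le_square_iff[symmetric])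
  qed (use assms(3) in \<open>simp add: L2_def\<close>)
  also have "\<dots> = (K * sqrt (measure lebesgue (I_rho \<rho>)))\<^sup>2"
    by (simp add: measure_restrict_space power_mult_distrib mult.commute)
  finally show ?thesis
    by (rule power2_le_imp_le) (simp add: assms(2))
qed

lemma L2_integrable:
  assumes "u \<in> L2 \<rho>"
  shows "integrable (lebesgue_on (I_rho \<rho>)) u"
proof (rule Bochner_Integration.integrable_bound)
  show "integrable (lebesgue_on (I_rho \<rho>)) (\<lambda>x. (u x)\<^sup>2 + 1)"
    using assms C0_integrable[of "\<lambda>x. 1" \<rho>]
    by (intro Bochner_Integration.integrable_add) (auto simp: L2_def C0_def)
  have "\<bar>a\<bar> \<le> a\<^sup>2 + 1" for a :: real
    using zero_le_power2[of "\<bar>a\<bar> - 1"] by (simp add: power2_eq_square algebra_simps)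
  then show "AE x in lebesgue_on (I_rho \<rho>). norm (u x) \<le> norm ((u x)\<^sup>2 + 1)"
    by simp
qed (use assms in \<open>simp add: L2_def\<close>)

text \<open>A form of Cauchy-Schwarz with the constant \<open>1 + m\<close>, \<open>m\<close> being
  the length of the interval. Integrating Young's inequality
  \<open>\<bar>u\<bar> \<le> u\<^sup>2 / t + t\<close> leaves the parameter \<open>t\<close> free,
  and taking \<open>t\<close> equal to the norm of \<open>u\<close> gives the bound.\<close>

lemma L2_integral_abs_le:
  assumes "u \<in> L2 \<rho>"
  shows "(LINT x|lebesgue_on (I_rho \<rho>). \<bar>u x\<bar>) \<le> L2_norm \<rho> u * (1 + measure lebesgue (I_rho \<rho>))"
proof -
  define m N where "m = measure lebesgue (I_rho \<rho>)" and "N = L2_norm \<rho> u"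
  have m0: "m \<ge> 0" by (simp add: m_def)
  have *: "(LINT x|lebesgue_on (I_rho \<rho>). \<bar>u x\<bar>) \<le> N\<^sup>2 / t + t * m" if "t > 0" for t
  proof -
    have "(LINT x|lebesgue_on (I_rho \<rho>). \<bar>u x\<bar>) \<le> (LINT x|lebesgue_on (I_rho \<rho>). (u x)\<^sup>2 / t + t)"
    proof (rule integral_mono)
      show "integrable (lebesgue_on (I_rho \<rho>)) (\<lambda>x. (u x)\<^sup>2 / t + t)"
        using assms C0_integrable[of "\<lambda>x. t" \<rho>]
        by (intro Bochner_Integration.integrable_add) (auto simp: L2_def C0_def)
      show "\<bar>u x\<bar> \<le> (u x)\<^sup>2 / t + t" for x
      proof -
        have "2 * \<bar>u x\<bar> * t \<le> (u x)\<^sup>2 + t * t"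
          using zero_le_power2[of "\<bar>u x\<bar> - t"] by (simp add: power2_eq_square algebra_simps)
        moreover have "0 \<le> \<bar>u x\<bar> * t"
          using that by simp
        ultimately have "\<bar>u x\<bar> * t \<le> (u x)\<^sup>2 + t * t"
          by linarith
        then show ?thesis
          using that by (simp add: field_simps)
      qed
    qed (use L2_integrable[OF assms] in simp)
    also have "\<dots> = N\<^sup>2 / t + t * m"
    proof -
      have "integrable (lebesgue_on (I_rho \<rho>)) (\<lambda>x. t)"
        by (intro C0_integrable) (simp add: C0_def)
      moreover have "integrable (lebesgue_on (I_rho \<rho>)) (\<lambda>x. (u x)\<^sup>2 / t)"
        using assms by (auto simp: L2_def)
      ultimately show ?thesis
        by (simp add: N_def m_def L2_norm_power2 measure_restrict_space mult.commute)
    qed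
    finally show ?thesis .
  qed
  show ?thesis
  proof (cases "N = 0")
    \<comment> \<open>The choice \<open>t = N\<close> would divide by zero here. Only
      \<open>t * m\<close> remains of the bound, and \<open>t\<close> may be arbitrarily
      small.\<close>
    case True
    have "(LINT x|lebesgue_on (I_rho \<rho>). \<bar>u x\<bar>) \<le> 0"
    proof (rule field_le_epsilon)
      fix e :: real assume "e > 0"
      have "(LINT x|lebesgue_on (I_rho \<rho>). \<bar>u x\<bar>) \<le> e / (1 + m) * m"
        using *[of "e / (1 + m)"] \<open>e > 0\<close> m0 True by simp
      also have "\<dots> \<le> 0 + e"
        using \<open>e > 0\<close> m0 by (simp add: field_simps)
      finally show "(LINT x|lebesgue_on (I_rho \<rho>). \<bar>u x\<bar>) \<le> 0 + e" .
    qed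
    then show ?thesis
      using True by (simp add: N_def)
  next
    case False
    then have "N > 0"
      using L2_norm_nonneg[of \<rho> u] by (simp add: N_def)
    with *[of N] show ?thesis
      by (simp add: N_def[symmetric] m_def[symmetric] power2_eq_square algebra_simps)
  qed
qed

section \<open>Approximation in the \<open>L2\<close> seminorm: truncation, continuous functions,
  polynomials\<close>

text \<open>Squared norms avoid the triangle inequality, which is replaced by
  \<open>(a - c)\<^sup>2 \<le> 2 (a - b)\<^sup>2 + 2 (b - c)\<^sup>2\<close>.\<close>

definition L2_approximable :: "real \<Rightarrow> (real \<Rightarrow> real) set \<Rightarrow> (real \<Rightarrow> real) \<Rightarrow> bool" where
  "L2_approximable \<rho> D u \<longleftrightarrow> (\<forall>e>0. \<exists>v\<in>D. (L2_norm \<rho> (\<lambda>x. v x - u x))\<^sup>2 < e)"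

text \<open>Density composes. Each of the two approximations is made with error
  \<open>e / 4\<close>, since the inequality for squares doubles both errors.\<close>

lemma L2_approximable_trans:
  assumes "L2_approximable \<rho> D u" "\<And>v. v \<in> D \<Longrightarrow> L2_approximable \<rho> E v"
    and "D \<subseteq> L2 \<rho>" "E \<subseteq> L2 \<rho>" "u \<in> L2 \<rho>"
  shows "L2_approximable \<rho> E u"
  unfolding L2_approximable_def
proof (intro allI impI)
  fix e :: real assume "e > 0"
  then obtain v where v: "v \<in> D" "(L2_norm \<rho> (\<lambda>x. v x - u x))\<^sup>2 < e / 4"
    using assms(1) unfolding L2_approximable_def by (metis zero_less_divide_iff zero_less_numeral)
  then obtain w where w: "w \<in> E" "(L2_norm \<rho> (\<lambda>x. w x - v x))\<^sup>2 < e / 4"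
    using assms(2) \<open>e > 0\<close> unfolding L2_approximable_def by (metis zero_less_divide_iff zero_less_numeral)
  have L2: "u \<in> L2 \<rho>" "v \<in> L2 \<rho>" "w \<in> L2 \<rho>"
    using v w assms by auto
  have int: "integrable (lebesgue_on (I_rho \<rho>)) (\<lambda>x. (w x - v x)\<^sup>2)"
    "integrable (lebesgue_on (I_rho \<rho>)) (\<lambda>x. (v x - u x)\<^sup>2)"
    "integrable (lebesgue_on (I_rho \<rho>)) (\<lambda>x. (w x - u x)\<^sup>2)"
    using L2_diff L2 by (auto simp: L2_def)
  have "(L2_norm \<rho> (\<lambda>x. w x - u x))\<^sup>2
      \<le> (LINT x|lebesgue_on (I_rho \<rho>). 2 * (w x - v x)\<^sup>2 + 2 * (v x - u x)\<^sup>2)"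
    unfolding L2_norm_power2
  proof (rule integral_mono)
    show "(w x - u x)\<^sup>2 \<le> 2 * (w x - v x)\<^sup>2 + 2 * (v x - u x)\<^sup>2" for x
      using zero_le_power2[of "(w x - v x) - (v x - u x)"] by (simp add: power2_eq_square algebra_simps)
  qed (use int in auto)
  also have "\<dots> = 2 * (L2_norm \<rho> (\<lambda>x. w x - v x))\<^sup>2 + 2 * (L2_norm \<rho> (\<lambda>x. v x - u x))\<^sup>2"
    using int by (simp add: L2_norm_power2)
  also have "\<dots> < e"
    using v w by simp
  finally show "\<exists>w\<in>E. (L2_norm \<rho> (\<lambda>x. w x - u x))\<^sup>2 < e"
    using w by blast
qed

text \<open>Dominated convergence applied to \<open>(s n - u)\<^sup>2\<close>, so the dominating
  function bounds the squared error and not the sequence.\<close>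

lemma L2_approximable_dominated:
  assumes "u \<in> L2 \<rho>" "\<And>n :: nat. s n \<in> D" "D \<subseteq> L2 \<rho>"
    and "AE x in lebesgue_on (I_rho \<rho>). (\<lambda>n. s n x) \<longlonglongrightarrow> u x"
    and "integrable (lebesgue_on (I_rho \<rho>)) w"
    and "\<And>n. AE x in lebesgue_on (I_rho \<rho>). (s n x - u x)\<^sup>2 \<le> w x"
  shows "L2_approximable \<rho> D u"
  unfolding L2_approximable_def
proof (intro allI impI)
  fix e :: real assume "e > 0"
  have [measurable]: "u \<in> borel_measurable (lebesgue_on (I_rho \<rho>))"
    "s n \<in> borel_measurable (lebesgue_on (I_rho \<rho>))" for n
    using assms by (auto simp: L2_def)
  have "(\<lambda>n. LINT x|lebesgue_on (I_rho \<rho>). (s n x - u x)\<^sup>2) \<longlonglongrightarrow> (LINT x|lebesgue_on (I_rho \<rho>). 0)"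
  proof (rule integral_dominated_convergence)
    show "AE x in lebesgue_on (I_rho \<rho>). (\<lambda>n. (s n x - u x)\<^sup>2) \<longlonglongrightarrow> 0"
      using assms(4)
    proof eventually_elim
      case (elim x)
      from tendsto_power[OF tendsto_diff[OF elim tendsto_const[of "u x"]], of 2]
      show ?case by simp
    qed
    show "integrable (lebesgue_on (I_rho \<rho>)) w" by fact
    show "AE x in lebesgue_on (I_rho \<rho>). norm ((s n x - u x)\<^sup>2) \<le> w x" for n
      using assms(6)[of n] by simp
  qed measurable
  then have "\<forall>\<^sub>F n in sequentially. (L2_norm \<rho> (\<lambda>x. s n x - u x))\<^sup>2 < e"
    unfolding L2_norm_power2 using \<open>e > 0\<close> by (intro order_tendstoD(2)) auto
  then obtain n where "(L2_norm \<rho> (\<lambda>x. s n x - u x))\<^sup>2 < e"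
    by (auto simp: eventually_sequentially)
  with assms(2)[of n] show "\<exists>v\<in>D. (L2_norm \<rho> (\<lambda>x. v x - u x))\<^sup>2 < e"
    by blast
qed

definition bounded_measurable :: "real \<Rightarrow> (real \<Rightarrow> real) set" where
  "bounded_measurable \<rho> =
     {u \<in> borel_measurable (lebesgue_on (I_rho \<rho>)). \<exists>K. \<forall>x\<in>I_rho \<rho>. \<bar>u x\<bar> \<le> K}"

lemma bounded_measurable_subset_L2: "bounded_measurable \<rho> \<subseteq> L2 \<rho>"
  by (auto simp: bounded_measurable_def intro: L2_bounded_measurable)

lemma L2_approximable_bounded_measurable:
  assumes "u \<in> L2 \<rho>"
  shows "L2_approximable \<rho> (bounded_measurable \<rho>) u"
proof (rule L2_approximable_dominated)
  define s where "s = (\<lambda>(n::nat) x. max (- real n) (min (real n) (u x)))"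
  have [measurable]: "u \<in> borel_measurable (lebesgue_on (I_rho \<rho>))"
    using assms by (auto simp: L2_def)
  show "s n \<in> bounded_measurable \<rho>" for n
  proof -
    have "s n \<in> borel_measurable (lebesgue_on (I_rho \<rho>))"
      unfolding s_def by measurable
    moreover have "\<forall>x. \<bar>s n x\<bar> \<le> real n"
      by (auto simp: s_def)
    ultimately show ?thesis
      by (auto simp: bounded_measurable_def)
  qed
  show "integrable (lebesgue_on (I_rho \<rho>)) (\<lambda>x. (u x)\<^sup>2)"
    using assms by (simp add: L2_def)
  \<comment> \<open>Truncation moves a value towards 0 without passing it, so the error is at most
    \<open>\<bar>u x\<bar>\<close>.\<close>
  show "AE x in lebesgue_on (I_rho \<rho>). (s n x - u x)\<^sup>2 \<le> (u x)\<^sup>2" for n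
    by (intro AE_I2) (auto simp: s_def abs_le_square_iff[symmetric] max_def min_def)
  have "(\<lambda>n. s n x) \<longlonglongrightarrow> u x" for x
  proof (rule tendsto_eventually)
    obtain N :: nat where N: "\<bar>u x\<bar> \<le> real N"
      using real_arch_simple by blast
    show "\<forall>\<^sub>F n in sequentially. s n x = u x"
      unfolding eventually_sequentially
    proof (intro exI[of _ N] allI impI)
      fix n assume "N \<le> n"
      then have "\<bar>u x\<bar> \<le> real n"
        using N by linarith
      then show "s n x = u x"
        by (auto simp: s_def)
    qed
  qed
  then show "AE x in lebesgue_on (I_rho \<rho>). (\<lambda>n. s n x) \<longlonglongrightarrow> u x"
    by simp
qed (use assms bounded_measurable_subset_L2 in auto)

text \<open>The definition of \<open>measurable_on\<close> supplies continuous functions that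
  converge to \<open>u\<close> off a negligible set, but without a common bound. Clamping them to
  \<open>[-K, K]\<close> keeps them continuous, fixes the limit \<open>u\<close>, and makes them
  dominated.\<close>

lemma L2_approximable_C0:
  assumes "u \<in> bounded_measurable \<rho>"
  shows "L2_approximable \<rho> (C0 \<rho>) u"
proof -
  obtain K where K: "\<And>x. x \<in> I_rho \<rho> \<Longrightarrow> \<bar>u x\<bar> \<le> K"
    and meas: "u \<in> borel_measurable (lebesgue_on (I_rho \<rho>))"
    using assms by (auto simp: bounded_measurable_def)
  have "u measurable_on I_rho \<rho>"
    using meas by (simp add: measurable_on_iff_borel_measurable)
  then obtain N g where N: "negligible N" and g: "\<And>n :: nat. continuous_on UNIV (g n)"
    and lim: "\<And>x. x \<notin> N \<Longrightarrow> (\<lambda>n. g n x) \<longlonglongrightarrow> (if x \<in> I_rho \<rho> then u x else 0)"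
    unfolding measurable_on_def by blast
  show ?thesis
  proof (rule L2_approximable_dominated)
    define s where "s = (\<lambda>n x. max (- K) (min K (g n x)))"
    show "s n \<in> C0 \<rho>" for n
      unfolding s_def C0_def
      by (auto intro!: continuous_intros continuous_on_subset[OF g])
    have "AE x in lebesgue. x \<notin> N"
      using N by (auto simp: negligible_iff_null_sets intro: AE_not_in)
    then have "AE x in lebesgue_on (I_rho \<rho>). x \<notin> N"
      by (subst AE_restrict_space_iff) (auto elim: eventually_mono)
    then show "AE x in lebesgue_on (I_rho \<rho>). (\<lambda>n. s n x) \<longlonglongrightarrow> u x"
    proof (rule AE_mp[OF _ AE_I2], intro impI)
      fix x assume x: "x \<in> space (lebesgue_on (I_rho \<rho>))" "x \<notin> N"
      then have "(\<lambda>n. s n x) \<longlonglongrightarrow> max (- K) (min K (u x))"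
        unfolding s_def using lim[of x] by (auto intro!: tendsto_intros)
      moreover have "max (- K) (min K (u x)) = u x"
        using K[of x] x by (auto simp: abs_le_iff)
      ultimately show "(\<lambda>n. s n x) \<longlonglongrightarrow> u x"
        by simp
    qed
    show "integrable (lebesgue_on (I_rho \<rho>)) (\<lambda>x. (2 * K)\<^sup>2)"
      by (intro C0_integrable) (simp add: C0_def)
    show "AE x in lebesgue_on (I_rho \<rho>). (s n x - u x)\<^sup>2 \<le> (2 * K)\<^sup>2" for n
    proof (rule AE_I2)
      fix x assume "x \<in> space (lebesgue_on (I_rho \<rho>))"
      then have "\<bar>u x\<bar> \<le> K"
        using K by simp
      then have "\<bar>s n x - u x\<bar> \<le> \<bar>2 * K\<bar>"
        by (auto simp: s_def)
      then show "(s n x - u x)\<^sup>2 \<le> (2 * K)\<^sup>2"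
        by (simp add: abs_le_square_iff)
    qed
  qed (use assms bounded_measurable_subset_L2 C0_subset_L2 in auto)
qed

lemma L2_approximable_C1:
  assumes "u \<in> C0 \<rho>"
  shows "L2_approximable \<rho> (C1 \<rho>) u"
  unfolding L2_approximable_def
proof (intro allI impI)
  fix e :: real assume "e > 0"
  define m where "m = measure lebesgue (I_rho \<rho>)"
  have m0: "m \<ge> 0" by (simp add: m_def)
  \<comment> \<open>A uniform error \<open>d\<close> costs at most
    \<open>d\<^sup>2 * m = e * m / (1 + m) < e\<close> in the squared norm. The denominator
    \<open>1 + m\<close> stays positive even for length zero, as nothing is assumed about
    \<open>\<rho>\<close> here.\<close>
  define d where "d = sqrt (e / (1 + m))"
  have "d > 0"
    using \<open>e > 0\<close> m0 by (simp add: d_def)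
  moreover have "compact (I_rho \<rho>)" "continuous_on (I_rho \<rho>) u"
    using assms by (auto simp: I_rho_def C0_def)
  ultimately obtain g where g: "real_polynomial_function g"
    and close: "\<And>x. x \<in> I_rho \<rho> \<Longrightarrow> \<bar>u x - g x\<bar> < d"
    using Stone_Weierstrass_real_polynomial_function by metis
  obtain g' where g': "real_polynomial_function g'" "\<And>x. (g has_real_derivative g' x) (at x)"
    using has_real_derivative_polynomial_function[OF g] by blast
  have "continuous_on (I_rho \<rho>) g'"
    using g'(1) by (intro continuous_on_polymonial_function) (simp add: real_polynomial_function_eq)
  moreover have "(g has_real_derivative g' x) (at x within I_rho \<rho>)" for x
    using g'(2) by (rule has_field_derivative_at_within)
  ultimately have gC1: "g \<in> C1 \<rho>"
    unfolding C1_def by blast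
  have "(L2_norm \<rho> (\<lambda>x. g x - u x))\<^sup>2 \<le> (d * sqrt m)\<^sup>2"
  proof (rule power_mono)
    show "L2_norm \<rho> (\<lambda>x. g x - u x) \<le> d * sqrt m"
      unfolding m_def
    proof (rule L2_norm_le_sup)
      show "(\<lambda>x. g x - u x) \<in> L2 \<rho>"
        using gC1 assms C1_subset_C0 C0_subset_L2 by (blast intro: L2_diff)
      show "\<bar>g x - u x\<bar> \<le> d" if "x \<in> I_rho \<rho>" for x
        using close[OF that] by simp
    qed (use \<open>d > 0\<close> in simp)
  qed (rule L2_norm_nonneg)
  also have "\<dots> = e / (1 + m) * m"
    using \<open>e > 0\<close> m0 by (simp add: power_mult_distrib d_def)
  also have "\<dots> < e"
    using \<open>e > 0\<close> m0 by (simp add: field_simps)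
  finally show "\<exists>v\<in>C1 \<rho>. (L2_norm \<rho> (\<lambda>x. v x - u x))\<^sup>2 < e"
    using gC1 by blast
qed

lemma C1_dense_L2:
  assumes "u \<in> L2 \<rho>"
  shows "L2_approximable \<rho> (C1 \<rho>) u"
proof -
  have "L2_approximable \<rho> (C0 \<rho>) u"
    by (rule L2_approximable_trans[OF L2_approximable_bounded_measurable[OF assms] L2_approximable_C0])
      (use assms bounded_measurable_subset_L2 C0_subset_L2 in auto)
  then show ?thesis
    by (rule L2_approximable_trans[OF _ L2_approximable_C1])
      (use assms C1_subset_C0 C0_subset_L2 in auto)
qed

subsection \<open>Functionals given by a continuous weight\<close>

text \<open>The restriction to \<open>L2 \<rho>\<close> gives the value \<open>undefined\<close>
  elsewhere, as \<open>is_L2_extension\<close> demands of an extension.\<close>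

definition weighted :: "real \<Rightarrow> (real \<Rightarrow> real) \<Rightarrow> (real \<Rightarrow> real) \<Rightarrow> real" where
  "weighted \<rho> w = (\<lambda>u\<in>L2 \<rho>. LINT x|lebesgue_on (I_rho \<rho>). w x * u x)"

lemma weighted_integrable:
  assumes "w \<in> C0 \<rho>" "u \<in> L2 \<rho>"
  shows "integrable (lebesgue_on (I_rho \<rho>)) (\<lambda>x. w x * u x)"
proof -
  obtain K where K: "K > 0" "\<And>x. x \<in> I_rho \<rho> \<Longrightarrow> \<bar>w x\<bar> \<le> K"
    using C0_bounded[OF assms(1)] by blast
  have [measurable]: "w \<in> borel_measurable (lebesgue_on (I_rho \<rho>))"
    "u \<in> borel_measurable (lebesgue_on (I_rho \<rho>))"
    using assms by (auto simp: L2_def C0_measurable)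
  show ?thesis
  proof (rule Bochner_Integration.integrable_bound)
    show "integrable (lebesgue_on (I_rho \<rho>)) (\<lambda>x. K * u x)"
      using L2_integrable[OF assms(2)] by simp
    show "AE x in lebesgue_on (I_rho \<rho>). norm (w x * u x) \<le> norm (K * u x)"
      using K by (intro AE_I2) (auto simp: abs_mult intro!: mult_right_mono)
  qed measurable
qed

lemma weighted_bounded:
  assumes "w \<in> C0 \<rho>"
  obtains K where "K > 0" "\<And>u. u \<in> L2 \<rho> \<Longrightarrow> \<bar>weighted \<rho> w u\<bar> \<le> K * L2_norm \<rho> u"
proof -
  obtain K where K: "K > 0" "\<And>x. x \<in> I_rho \<rho> \<Longrightarrow> \<bar>w x\<bar> \<le> K"
    using C0_bounded[OF assms] by blast
  show thesis
  proof
    show "K * (1 + measure lebesgue (I_rho \<rho>)) > 0"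
      using K by (intro mult_pos_pos) (auto intro: add_pos_nonneg)
    fix u assume u: "u \<in> L2 \<rho>"
    have "\<bar>weighted \<rho> w u\<bar> \<le> (LINT x|lebesgue_on (I_rho \<rho>). \<bar>w x * u x\<bar>)"
      using u by (simp add: weighted_def)
    also have "\<dots> \<le> (LINT x|lebesgue_on (I_rho \<rho>). K * \<bar>u x\<bar>)"
    proof (rule integral_mono)
      show "\<bar>w x * u x\<bar> \<le> K * \<bar>u x\<bar>" if "x \<in> space (lebesgue_on (I_rho \<rho>))" for x
        using K that by (auto simp: abs_mult intro!: mult_right_mono)
    qed (use weighted_integrable[OF assms u] L2_integrable[OF u] in auto)
    also have "\<dots> \<le> K * (L2_norm \<rho> u * (1 + measure lebesgue (I_rho \<rho>)))"
      using L2_integral_abs_le[OF u] K by simp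
    finally show "\<bar>weighted \<rho> w u\<bar> \<le> K * (1 + measure lebesgue (I_rho \<rho>)) * L2_norm \<rho> u"
      by (simp add: mult_ac)
  qed
qed

text \<open>A bounded linear functional is Lipschitz: its increment is its value at the difference
  \<open>v - u\<close>, so \<open>d = e / K\<close> serves at every \<open>u\<close>.\<close>

lemma weighted_continuous:
  assumes "w \<in> C0 \<rho>"
  shows "L2_continuous \<rho> (weighted \<rho> w)"
  unfolding L2_continuous_def
proof (intro ballI allI impI)
  fix u and e :: real assume u: "u \<in> L2 \<rho>" and "e > 0"
  obtain K where K: "K > 0" "\<And>u. u \<in> L2 \<rho> \<Longrightarrow> \<bar>weighted \<rho> w u\<bar> \<le> K * L2_norm \<rho> u"
    using weighted_bounded[OF assms] by blast
  have "\<bar>weighted \<rho> w v - weighted \<rho> w u\<bar> < e"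
    if v: "v \<in> L2 \<rho>" and close: "L2_norm \<rho> (\<lambda>x. v x - u x) < e / K" for v
  proof -
    have "weighted \<rho> w v - weighted \<rho> w u = weighted \<rho> w (\<lambda>x. v x - u x)"
      using weighted_integrable[OF assms u] weighted_integrable[OF assms v] u v L2_diff[OF v u]
      by (simp add: weighted_def right_diff_distrib)
    then have "\<bar>weighted \<rho> w v - weighted \<rho> w u\<bar> \<le> K * L2_norm \<rho> (\<lambda>x. v x - u x)"
      using K(2)[OF L2_diff[OF v u]] by simp
    also have "\<dots> < e"
      using close \<open>K > 0\<close> by (simp add: field_simps)
    finally show ?thesis .
  qed
  moreover have "e / K > 0"
    using \<open>e > 0\<close> \<open>K > 0\<close> by simp
  ultimately show "\<exists>d>0. \<forall>v\<in>L2 \<rho>. L2_norm \<rho> (\<lambda>x. v x - u x) < d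
      \<longrightarrow> \<bar>weighted \<rho> w v - weighted \<rho> w u\<bar> < e"
    by blast
qed

lemma L2_continuous_eqI:
  assumes "L2_continuous \<rho> G" "L2_continuous \<rho> H" "\<And>v. v \<in> D \<Longrightarrow> G v = H v"
    and "u \<in> L2 \<rho>" "L2_approximable \<rho> D u" "D \<subseteq> L2 \<rho>"
  shows "G u = H u"
proof -
  have "\<bar>G u - H u\<bar> \<le> 0"
  proof (rule field_le_epsilon)
    fix e :: real assume "e > 0"
    then have "e / 2 > 0" by simp
    obtain d1 where d1: "d1 > 0"
      "\<And>v. v \<in> L2 \<rho> \<Longrightarrow> L2_norm \<rho> (\<lambda>x. v x - u x) < d1 \<Longrightarrow> \<bar>G v - G u\<bar> < e / 2"
      using assms(1,4) \<open>e / 2 > 0\<close> unfolding L2_continuous_def by blast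
    obtain d2 where d2: "d2 > 0"
      "\<And>v. v \<in> L2 \<rho> \<Longrightarrow> L2_norm \<rho> (\<lambda>x. v x - u x) < d2 \<Longrightarrow> \<bar>H v - H u\<bar> < e / 2"
      using assms(2,4) \<open>e / 2 > 0\<close> unfolding L2_continuous_def by blast
    \<comment> \<open>\<open>L2_approximable\<close> controls squared norms, so the radius common to
      both functionals enters squared.\<close>
    have "(min d1 d2)\<^sup>2 > 0"
      using d1 d2 by simp
    then obtain v where v: "v \<in> D" "(L2_norm \<rho> (\<lambda>x. v x - u x))\<^sup>2 < (min d1 d2)\<^sup>2"
      using assms(5) unfolding L2_approximable_def by blast
    then have "L2_norm \<rho> (\<lambda>x. v x - u x) < min d1 d2"
      using d1(1) d2(1) by (intro power_less_imp_less_base[OF v(2)]) simp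
    then have "\<bar>G v - G u\<bar> < e / 2" "\<bar>H v - H u\<bar> < e / 2"
      using d1 d2 v assms(6) by auto
    with assms(3)[OF v(1)] show "\<bar>G u - H u\<bar> \<le> 0 + e"
      by linarith
  qed
  then show ?thesis by simp
qed

text \<open>The condition \<open>C1 \<rho> \<subseteq> D \<subseteq> C0 \<rho>\<close> covers both
  domains in use, \<open>C1\<close> and \<open>C0\<close>. Such a \<open>D\<close> inherits density
  from \<open>C1\<close> and lies in \<open>L2\<close>, so two continuous functionals that agree on
  it agree everywhere.\<close>

lemma L2_extension_unique:
  assumes "C1 \<rho> \<subseteq> D" "D \<subseteq> C0 \<rho>" "is_L2_extension \<rho> D F G" "is_L2_extension \<rho> D F H"
  shows "G = H"
proof (rule extensionalityI)
  show "G \<in> extensional (L2 \<rho>)" "H \<in> extensional (L2 \<rho>)"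
    using assms by (auto simp: is_L2_extension_def)
  fix u assume u: "u \<in> L2 \<rho>"
  show "G u = H u"
    by (rule L2_continuous_eqI[OF _ _ _ u C1_dense_L2[OF u]])
      (use assms C0_subset_L2 in \<open>auto simp: is_L2_extension_def subset_eq\<close>)
qed

text \<open>The gauge integral is used because integration by parts takes place there. A continuous
  weight is bounded on the compact interval, which is what makes the functional continuous on
  \<open>L2\<close>.\<close>

definition representable :: "real \<Rightarrow> (real \<Rightarrow> real) set \<Rightarrow> ((real \<Rightarrow> real) \<Rightarrow> real) \<Rightarrow> bool" where
  "representable \<rho> D F \<longleftrightarrow>
     (\<exists>w\<in>C0 \<rho>. \<forall>u\<in>D. F u = integral (I_rho \<rho>) (\<lambda>x. w x * u x))"

lemma representable_extension:
  assumes "C1 \<rho> \<subseteq> D" "D \<subseteq> C0 \<rho>" "representable \<rho> D F"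
  obtains w where "w \<in> C0 \<rho>" "is_L2_extension \<rho> D F (weighted \<rho> w)"
proof -
  obtain w where w: "w \<in> C0 \<rho>" "\<And>u. u \<in> D \<Longrightarrow> F u = integral (I_rho \<rho>) (\<lambda>x. w x * u x)"
    using assms(3) unfolding representable_def by blast
  have "weighted \<rho> w u = F u" if "u \<in> D" for u
  proof -
    have u: "u \<in> L2 \<rho>"
      using that assms(2) C0_subset_L2 by blast
    \<comment> \<open>The product of a continuous weight and an \<open>L2\<close> function is
      Lebesgue integrable, so its Lebesgue and gauge integrals agree.\<close>
    show ?thesis
      using lebesgue_integral_eq_integral[OF weighted_integrable[OF w(1) u]] u w(2)[OF that]
      by (simp add: weighted_def)
  qed
  then have "is_L2_extension \<rho> D F (weighted \<rho> w)"
    unfolding is_L2_extension_def using weighted_continuous[OF w(1)]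
    by (auto simp: weighted_def)
  with w(1) show thesis by (rule that)
qed

lemma representable_ex1:
  assumes "C1 \<rho> \<subseteq> D" "D \<subseteq> C0 \<rho>" "representable \<rho> D F"
  shows "\<exists>!G. is_L2_extension \<rho> D F G"
proof -
  obtain w where w: "is_L2_extension \<rho> D F (weighted \<rho> w)"
    by (rule representable_extension[OF assms])
  show ?thesis
  proof (rule ex1I)
    show "is_L2_extension \<rho> D F (weighted \<rho> w)" by fact
    show "G = weighted \<rho> w" if "is_L2_extension \<rho> D F G" for G
      by (rule L2_extension_unique[OF assms(1,2) that w])
  qed
qed

lemma representable_L2_extension_bounded:
  assumes "C1 \<rho> \<subseteq> D" "D \<subseteq> C0 \<rho>" "representable \<rho> D F"
  obtains K where "K > 0" "\<And>u. u \<in> L2 \<rho> \<Longrightarrow> \<bar>L2_extension \<rho> D F u\<bar> \<le> K * L2_norm \<rho> u"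
proof -
  obtain w where w: "w \<in> C0 \<rho>" "is_L2_extension \<rho> D F (weighted \<rho> w)"
    by (rule representable_extension[OF assms(1-3)])
  have eq: "L2_extension \<rho> D F = weighted \<rho> w"
    unfolding L2_extension_def
  proof (rule the_equality)
    show "is_L2_extension \<rho> D F (weighted \<rho> w)" by fact
    show "G = weighted \<rho> w" if "is_L2_extension \<rho> D F G" for G
      by (rule L2_extension_unique[OF assms(1,2) that w(2)])
  qed
  show thesis
    by (rule weighted_bounded[OF w(1), folded eq]) (rule that)
qed

text \<open>Stated for general functionals and basis functions so as to serve both operators. Each
  coefficient is bounded by the norm of \<open>u\<close> and each basis function by its supremum;
  the resulting pointwise bound becomes an \<open>L2\<close> bound because the interval has finite
  length.\<close>

lemma quasi_interpolant_bounded: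
  assumes "C1 \<rho> \<subseteq> D" "D \<subseteq> C0 \<rho>" "finite A"
    and rep: "\<And>i. i \<in> A \<Longrightarrow> representable \<rho> D (F i)"
    and phi: "\<And>i. i \<in> A \<Longrightarrow> \<phi> i \<in> C0 \<rho>"
  shows "\<exists>C>0. \<forall>u\<in>L2 \<rho>. (\<lambda>x. \<Sum>i\<in>A. L2_extension \<rho> D (F i) u * \<phi> i x) \<in> L2 \<rho> \<and>
      L2_norm \<rho> (\<lambda>x. \<Sum>i\<in>A. L2_extension \<rho> D (F i) u * \<phi> i x) \<le> C * L2_norm \<rho> u"
proof -
  have "\<forall>i\<in>A. \<exists>K. K > 0 \<and> (\<forall>u\<in>L2 \<rho>. \<bar>L2_extension \<rho> D (F i) u\<bar> \<le> K * L2_norm \<rho> u)"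
  proof
    fix i assume "i \<in> A"
    obtain K where "K > 0" "\<And>u. u \<in> L2 \<rho> \<Longrightarrow> \<bar>L2_extension \<rho> D (F i) u\<bar> \<le> K * L2_norm \<rho> u"
      by (rule representable_L2_extension_bounded[OF assms(1,2) rep[OF \<open>i \<in> A\<close>]]) (rule that)
    then show "\<exists>K. K > 0 \<and> (\<forall>u\<in>L2 \<rho>. \<bar>L2_extension \<rho> D (F i) u\<bar> \<le> K * L2_norm \<rho> u)"
      by blast
  qed
  from bchoice[OF this] obtain K where K: "\<And>i. i \<in> A \<Longrightarrow> K i > 0"
    "\<And>i u. i \<in> A \<Longrightarrow> u \<in> L2 \<rho> \<Longrightarrow> \<bar>L2_extension \<rho> D (F i) u\<bar> \<le> K i * L2_norm \<rho> u"
    by blast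
  have "\<forall>i\<in>A. \<exists>M. M > 0 \<and> (\<forall>x\<in>I_rho \<rho>. \<bar>\<phi> i x\<bar> \<le> M)"
  proof
    fix i assume "i \<in> A"
    obtain M where "M > 0" "\<And>x. x \<in> I_rho \<rho> \<Longrightarrow> \<bar>\<phi> i x\<bar> \<le> M"
      by (rule C0_bounded[OF phi[OF \<open>i \<in> A\<close>]]) (rule that)
    then show "\<exists>M. M > 0 \<and> (\<forall>x\<in>I_rho \<rho>. \<bar>\<phi> i x\<bar> \<le> M)"
      by blast
  qed
  from bchoice[OF this] obtain M where M: "\<And>i. i \<in> A \<Longrightarrow> M i > 0"
    "\<And>i x. i \<in> A \<Longrightarrow> x \<in> I_rho \<rho> \<Longrightarrow> \<bar>\<phi> i x\<bar> \<le> M i"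
    by blast
  define S where "S = (\<Sum>i\<in>A. K i * M i)"
  have S0: "S \<ge> 0"
    unfolding S_def using K(1) M(1) by (intro sum_nonneg mult_nonneg_nonneg) (auto intro: less_imp_le)
  \<comment> \<open>The summand 1 makes the constant positive even when the product
    vanishes.\<close>
  define C where "C = S * sqrt (measure lebesgue (I_rho \<rho>)) + 1"
  have C: "C > 0"
    using S0 by (auto simp: C_def intro: add_nonneg_pos)
  show ?thesis
  proof (intro exI[of _ C] conjI ballI C)
    fix u assume u: "u \<in> L2 \<rho>"
    define p where "p = (\<lambda>x. \<Sum>i\<in>A. L2_extension \<rho> D (F i) u * \<phi> i x)"
    have p: "p \<in> L2 \<rho>"
    proof -
      have "p \<in> C0 \<rho>"
        using phi unfolding p_def C0_def by (auto intro!: continuous_intros)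
      then show ?thesis
        using C0_subset_L2 by blast
    qed
    then show "(\<lambda>x. \<Sum>i\<in>A. L2_extension \<rho> D (F i) u * \<phi> i x) \<in> L2 \<rho>"
      by (simp add: p_def)
    have "L2_norm \<rho> p \<le> (S * L2_norm \<rho> u) * sqrt (measure lebesgue (I_rho \<rho>))"
    proof (rule L2_norm_le_sup[OF _ _ p])
      fix x assume x: "x \<in> I_rho \<rho>"
      have "\<bar>p x\<bar> \<le> (\<Sum>i\<in>A. \<bar>L2_extension \<rho> D (F i) u * \<phi> i x\<bar>)"
        unfolding p_def by (rule sum_abs)
      also have "\<dots> \<le> (\<Sum>i\<in>A. (K i * L2_norm \<rho> u) * M i)"
        unfolding abs_mult using K(2)[OF _ u] M(2)[OF _ x]
        by (intro sum_mono mult_mono) (auto intro: order_trans[OF abs_ge_zero])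
      also have "\<dots> = S * L2_norm \<rho> u"
        by (simp add: S_def sum_distrib_left sum_distrib_right mult_ac)
      finally show "\<bar>p x\<bar> \<le> S * L2_norm \<rho> u" .
    qed (simp add: S0 L2_norm_nonneg)
    also have "\<dots> \<le> C * L2_norm \<rho> u"
      using L2_norm_nonneg[of \<rho> u] by (simp add: C_def algebra_simps)
    finally show "L2_norm \<rho> (\<lambda>x. \<Sum>i\<in>A. L2_extension \<rho> D (F i) u * \<phi> i x) \<le> C * L2_norm \<rho> u"
      by (simp add: p_def)
  qed
qed

subsection \<open>The cut-off function and integration by parts\<close>

text \<open>The profile \<open>exp (-1 / t)\<close>, extended by zero: \<open>\<eta> x = C * flat (1 - x\<^sup>2)\<close>, so that the
  regularity of \<open>\<eta>\<close> at \<open>\<plusminus>1\<close> is that of \<open>flat\<close> at 0.\<close>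

definition flat :: "real \<Rightarrow> real" where
  "flat t = (if t > 0 then exp (- 1 / t) else 0)"

definition flat' :: "real \<Rightarrow> real" where
  "flat' t = (if t > 0 then exp (- 1 / t) / t\<^sup>2 else 0)"

text \<open>Cubing \<open>y \<le> exp y\<close> at \<open>y = 1 / (3 * t)\<close> gives the bound.
  The third power is chosen so that a factor \<open>t\<close> is left after the division by
  \<open>t\<^sup>2\<close> in \<open>flat'\<close>.\<close>

lemma exp_minus_inverse_le:
  fixes t :: real
  assumes "t > 0"
  shows "exp (- 1 / t) \<le> 27 * t ^ 3"
proof -
  have "1 / (3 * t) \<le> exp (1 / (3 * t))"
    using exp_ge_add_one_self[of "1 / (3 * t)"] by linarith
  then have "(1 / (3 * t)) ^ 3 \<le> exp (1 / (3 * t)) ^ 3"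
    using assms by (intro power_mono) auto
  also have "\<dots> = exp (1 / t)"
    by (simp add: exp_of_nat_mult[symmetric])
  finally have "1 \<le> exp (1 / t) * (27 * t ^ 3)"
    using assms by (simp add: power_divide power_mult_distrib field_simps)
  then show ?thesis
    by (simp add: exp_minus field_simps)
qed

lemma flat_le: "\<bar>flat t\<bar> \<le> 27 * \<bar>t\<bar> ^ 3"
  using exp_minus_inverse_le[of t] by (simp add: flat_def)

lemma flat'_le: "\<bar>flat' t\<bar> \<le> 27 * \<bar>t\<bar>"
proof (cases "t > 0")
  case True
  then have "exp (- 1 / t) / t\<^sup>2 \<le> 27 * t ^ 3 / t\<^sup>2"
    using exp_minus_inverse_le[of t] by (intro divide_right_mono) auto
  also have "\<dots> = 27 * t"
    using True by (simp add: power2_eq_square power3_eq_cube)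
  finally show ?thesis
    using True by (simp add: flat'_def)
qed (simp add: flat'_def)

lemma flat_has_derivative: "(flat has_real_derivative flat' t) (at t)"
proof -
  consider "t > 0" | "t < 0" | "t = 0" by linarith
  then show ?thesis
  proof cases
    case 1
    have "((\<lambda>t. exp (- 1 / t)) has_real_derivative exp (- 1 / t) / t\<^sup>2) (at t)"
      using 1 by (auto intro!: derivative_eq_intros simp: power2_eq_square)
    then have "(flat has_real_derivative exp (- 1 / t) / t\<^sup>2) (at t)"
      by (rule has_field_derivative_transform_within_open[of _ _ _ "{0<..}"])
        (use 1 in \<open>auto simp: flat_def\<close>)
    with 1 show ?thesis by (simp add: flat'_def)
  next
    case 2
    have "((\<lambda>t. 0) has_real_derivative 0) (at t)"
      by simp
    then have "(flat has_real_derivative 0) (at t)"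
      by (rule has_field_derivative_transform_within_open[of _ _ _ "{..<0}"])
        (use 2 in \<open>auto simp: flat_def\<close>)
    with 2 show ?thesis by (simp add: flat'_def)
  next
    case 3
    \<comment> \<open>At 0 the two formulas meet, so the difference quotient itself is estimated;
      the cubic bound on \<open>flat\<close> makes it \<open>O(h\<^sup>2)\<close>.\<close>
    have "((\<lambda>h. flat h / h) \<longlongrightarrow> 0) (at 0)"
    proof (rule Lim_null_comparison)
      show "\<forall>\<^sub>F h in at 0. norm (flat h / h) \<le> 27 * \<bar>h\<bar> ^ 2"
      proof (rule eventually_at_filter[THEN iffD2], rule always_eventually, intro allI impI)
        fix h :: real assume "h \<noteq> 0"
        with flat_le[of h] show "norm (flat h / h) \<le> 27 * \<bar>h\<bar> ^ 2"
          by (simp add: abs_divide power2_eq_square power3_eq_cube field_simps)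
      qed
      show "((\<lambda>h::real. 27 * \<bar>h\<bar> ^ 2) \<longlongrightarrow> 0) (at 0)"
        by (auto intro!: tendsto_eq_intros)
    qed
    then show ?thesis
      using 3 by (simp add: DERIV_def flat_def flat'_def)
  qed
qed

lemma isCont_flat': "isCont flat' t"
proof -
  consider "t > 0" | "t < 0" | "t = 0" by linarith
  then show ?thesis
  proof cases
    case 1
    have "isCont (\<lambda>t. exp (- 1 / t) / t\<^sup>2) t"
      using 1 by (auto intro!: continuous_intros)
    moreover have "\<forall>\<^sub>F x in nhds t. flat' x = exp (- 1 / x) / x\<^sup>2"
      using eventually_nhds_in_open[of "{0<..}" t] 1 by (auto elim!: eventually_mono simp: flat'_def)
    ultimately show ?thesis
      by (simp add: isCont_cong)
  next
    case 2
    have "\<forall>\<^sub>F x in nhds t. flat' x = 0"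
      using eventually_nhds_in_open[of "{..<0}" t] 2 by (auto elim!: eventually_mono simp: flat'_def)
    then show ?thesis
      by (simp add: isCont_cong)
  next
    case 3
    have "(flat' \<longlongrightarrow> 0) (at 0)"
    proof (rule Lim_null_comparison)
      show "\<forall>\<^sub>F h in at 0. norm (flat' h) \<le> 27 * \<bar>h\<bar>"
        using flat'_le by simp
      show "((\<lambda>h::real. 27 * \<bar>h\<bar>) \<longlongrightarrow> 0) (at 0)"
        by (auto intro!: tendsto_eq_intros)
    qed
    then show ?thesis
      using 3 by (simp add: isCont_def flat'_def)
  qed
qed

lemma eta_with_eq_flat: "eta_with C x = C * flat (1 - x\<^sup>2)"
proof (cases "\<bar>x\<bar> < 1")
  case True
  then have "x\<^sup>2 < 1"
    by (simp add: abs_square_less_1)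
  moreover from this have "1 / (x\<^sup>2 - 1) = - 1 / (1 - x\<^sup>2)"
    by (simp add: field_simps)
  ultimately show ?thesis
    using True by (simp add: eta_with_def flat_def)
next
  case False
  then have "\<not> x\<^sup>2 < 1"
    by (simp add: abs_square_less_1)
  with False show ?thesis
    by (simp add: eta_with_def flat_def)
qed

section \<open>Integration by parts and primitives\<close>

lemma integral_by_parts:
  fixes f g f' g' :: "real \<Rightarrow> real"
  assumes "a \<le> b" "continuous_on {a..b} f'" "continuous_on {a..b} g'"
    and f: "\<And>x. x \<in> {a..b} \<Longrightarrow> (f has_real_derivative f' x) (at x within {a..b})"
    and g: "\<And>x. x \<in> {a..b} \<Longrightarrow> (g has_real_derivative g' x) (at x within {a..b})"
  shows "integral {a..b} (\<lambda>x. f x * g' x) = f b * g b - f a * g a - integral {a..b} (\<lambda>x. f' x * g x)"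
proof -
  have cont: "continuous_on {a..b} f" "continuous_on {a..b} g"
    using DERIV_continuous_on[OF f] DERIV_continuous_on[OF g] by simp_all
  have "((\<lambda>x. f x * g' x + f' x * g x) has_integral (f b * g b - f a * g a)) {a..b}"
  proof (rule fundamental_theorem_of_calculus[OF assms(1)])
    fix x assume "x \<in> {a..b}"
    from DERIV_mult'[OF f[OF this] g[OF this]]
    show "((\<lambda>x. f x * g x) has_vector_derivative f x * g' x + f' x * g x) (at x within {a..b})"
      by (simp add: has_real_derivative_iff_has_vector_derivative)
  qed
  then have "integral {a..b} (\<lambda>x. f x * g' x + f' x * g x) = f b * g b - f a * g a"
    by (rule integral_unique)
  moreover have "integral {a..b} (\<lambda>x. f x * g' x + f' x * g x)
      = integral {a..b} (\<lambda>x. f x * g' x) + integral {a..b} (\<lambda>x. f' x * g x)"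
    using cont assms(2,3)
    by (intro Henstock_Kurzweil_Integration.integral_add integrable_continuous_real continuous_intros)
  ultimately show ?thesis
    by simp
qed

text \<open>Based at the left end of the interval, so that it vanishes there and contributes no left
  boundary term.\<close>

definition primitive :: "real \<Rightarrow> (real \<Rightarrow> real) \<Rightarrow> real \<Rightarrow> real" where
  "primitive \<rho> v x = integral {-\<rho>..x} v"

lemma primitive_derivative:
  assumes "v \<in> C0 \<rho>" "x \<in> I_rho \<rho>"
  shows "(primitive \<rho> v has_real_derivative v x) (at x within I_rho \<rho>)"
  unfolding primitive_def using assms
  by (auto simp: C0_def I_rho_def intro: integral_has_real_derivative)

lemma primitive_in_C0: "v \<in> C0 \<rho> \<Longrightarrow> primitive \<rho> v \<in> C0 \<rho>"
  using DERIV_continuous_on[OF primitive_derivative] by (simp add: C0_def)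

section \<open>Cut-off kernels around a node\<close>

text \<open>Common abstraction of \<open>eta_l\<close> (centre 0) and \<open>eta_r\<close> (centre
  1): a continuously differentiable function vanishing outside the ball of radius
  \<open>\<rho>\<close> around a centre in \<open>[0, 1]\<close>. This position of the centre keeps
  the ball inside \<open>I_rho \<rho>\<close>.\<close>

locale kernel =
  fixes \<rho> c :: real and k k' :: "real \<Rightarrow> real"
  assumes radius: "\<rho> > 0" and centre: "0 \<le> c" "c \<le> 1"
    and deriv_kernel: "\<And>x. (k has_real_derivative k' x) (at x)"
    and cont_deriv_kernel: "continuous_on UNIV k'"
    and kernel_eq_0: "\<And>x. \<bar>x - c\<bar> \<ge> \<rho> \<Longrightarrow> k x = 0"
begin

lemma ball_subset: "ball c \<rho> \<subseteq> I_rho \<rho>"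
  using centre by (auto simp: I_rho_def dist_real_def)

lemma ball_subset_interior: "ball c \<rho> \<subseteq> interior (I_rho \<rho>)"
  by (simp add: ball_subset interior_maximal)

lemma kernel_in_C0: "k \<in> C0 \<rho>"
  using DERIV_continuous_on[OF has_field_derivative_at_within[OF deriv_kernel]]
  by (simp add: C0_def)

lemma deriv_kernel_in_C0: "k' \<in> C0 \<rho>"
  using cont_deriv_kernel by (auto simp: C0_def intro: continuous_on_subset)

lemma kernel_set_integrable:
  assumes "f \<in> C0 \<rho>"
  shows "set_integrable lborel (ball c \<rho>) (\<lambda>x. k x * f x)"
proof (rule set_integrable_subset)
  show "set_integrable lborel (I_rho \<rho>) (\<lambda>x. k x * f x)"
    using kernel_in_C0 assms unfolding I_rho_def C0_def
    by (auto intro!: borel_integrable_atLeastAtMost' continuous_intros)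
qed (use ball_subset in auto)

text \<open>Passes from the Lebesgue integral over the ball, as in the weighted node functionals, to
  the gauge integral over the whole interval; the kernel is zero on the rest.\<close>

lemma kernel_integral:
  assumes "f \<in> C0 \<rho>"
  shows "(LBINT x:ball c \<rho>. k x * f x) = integral (I_rho \<rho>) (\<lambda>x. k x * f x)"
proof -
  have "(LBINT x:ball c \<rho>. k x * f x) = integral (ball c \<rho>) (\<lambda>x. k x * f x)"
    by (rule set_borel_integral_eq_integral(2)[OF kernel_set_integrable[OF assms]])
  also have "\<dots> = integral (I_rho \<rho>) (\<lambda>x. if x \<in> ball c \<rho> then k x * f x else 0)"
    unfolding integral_restrict_Int using ball_subset by (simp only: Int_absorb1 Int_absorb2)
  also have "\<dots> = integral (I_rho \<rho>) (\<lambda>x. k x * f x)"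
    using kernel_eq_0 by (intro Henstock_Kurzweil_Integration.integral_cong)
      (auto simp: dist_real_def abs_minus_commute not_less)
  finally show ?thesis .
qed

text \<open>The factor that a kernel contributes when the integrand depends on the other node
  only.\<close>

definition mass :: real where
  "mass = (LBINT x:ball c \<rho>. k x)"

lemma mass_eq: "mass = integral (I_rho \<rho>) k"
  using kernel_integral[of "\<lambda>x. 1"] by (simp add: mass_def C0_def)

lemma kernel_set_integrable': "set_integrable lborel (ball c \<rho>) k"
  using kernel_set_integrable[of "\<lambda>x. 1"] by (simp add: C0_def)

lemma kernel_integral_deriv:
  assumes "continuous_on (I_rho \<rho>) u'"
    and "\<And>x. x \<in> I_rho \<rho> \<Longrightarrow> (u has_real_derivative u' x) (at x within I_rho \<rho>)"
  shows "integral (I_rho \<rho>) (\<lambda>x. k x * u' x) = integral (I_rho \<rho>) (\<lambda>x. - k' x * u x)"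
proof -
  have "integral (I_rho \<rho>) (\<lambda>x. k x * u' x)
      = k (1 + \<rho>) * u (1 + \<rho>) - k (- \<rho>) * u (- \<rho>) - integral (I_rho \<rho>) (\<lambda>x. k' x * u x)"
    unfolding I_rho_def
    by (rule integral_by_parts)
      (use assms radius deriv_kernel deriv_kernel_in_C0 in
        \<open>auto simp: I_rho_def C0_def intro: has_field_derivative_at_within\<close>)
  \<comment> \<open>Both ends of the interval are at distance at least \<open>\<rho>\<close> from a
    centre in \<open>[0, 1]\<close>, so the boundary terms vanish.\<close>
  moreover have "k (1 + \<rho>) = 0" "k (- \<rho>) = 0"
    using centre radius by (auto intro!: kernel_eq_0)
  ultimately show ?thesis
    by simp
qed

text \<open>Integration by parts with the primitives of \<open>v\<close> and \<open>k\<close>. Only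
  the right boundary term survives; it equals \<open>mass\<close> times the integral of
  \<open>v\<close> and is absorbed into the weight. The new weight at \<open>x\<close> is the part
  of the mass lying to the right of \<open>x\<close>.\<close>

lemma kernel_integral_primitive:
  assumes "v \<in> C0 \<rho>"
  shows "integral (I_rho \<rho>) (\<lambda>x. k x * primitive \<rho> v x)
       = integral (I_rho \<rho>) (\<lambda>x. (mass - primitive \<rho> k x) * v x)"
proof -
  have "integral (I_rho \<rho>) (\<lambda>x. primitive \<rho> v x * k x)
      = primitive \<rho> v (1 + \<rho>) * primitive \<rho> k (1 + \<rho>) - primitive \<rho> v (- \<rho>) * primitive \<rho> k (- \<rho>)
        - integral (I_rho \<rho>) (\<lambda>x. v x * primitive \<rho> k x)"
    unfolding I_rho_def
    by (rule integral_by_parts)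
      (use assms radius kernel_in_C0 primitive_derivative in \<open>auto simp: I_rho_def C0_def\<close>)
  also have "\<dots> = mass * integral (I_rho \<rho>) v - integral (I_rho \<rho>) (\<lambda>x. v x * primitive \<rho> k x)"
    by (simp add: primitive_def mass_eq I_rho_def)
  also have "\<dots> = integral (I_rho \<rho>) (\<lambda>x. mass * v x - v x * primitive \<rho> k x)"
    using assms primitive_in_C0[OF kernel_in_C0]
    by (subst Henstock_Kurzweil_Integration.integral_diff)
      (auto simp: I_rho_def C0_def intro!: integrable_continuous_real continuous_intros)
  finally show ?thesis
    by (simp add: algebra_simps)
qed

end

lemma eta_kernel:
  assumes "\<rho> > 0" "0 \<le> c" "c \<le> 1"
  shows "\<exists>k'. kernel \<rho> c (\<lambda>x. 1 / \<rho> * eta ((x - c) / \<rho>)) k'"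
proof -
  \<comment> \<open>The normalisation of \<open>\<eta>\<close> plays no role, so \<open>THE\<close> may stay uninterpreted.\<close>
  define C where "C = (THE C. (LINT x|lborel. eta_with C x) = 1)"
  have eta_eq: "eta = (\<lambda>x. C * flat (1 - x\<^sup>2))"
    unfolding eta_def C_def by (simp add: fun_eq_iff eta_with_eq_flat)
  define \<eta>' where "\<eta>' = (\<lambda>x. C * (flat' (1 - x\<^sup>2) * (- 2 * x)))"
  have deriv: "(eta has_real_derivative \<eta>' x) (at x)" for x
  proof -
    have "((\<lambda>x::real. 1 - x\<^sup>2) has_real_derivative - 2 * x) (at x)"
      by (auto intro!: derivative_eq_intros)
    from DERIV_chain2[OF flat_has_derivative this]
    show ?thesis
      unfolding eta_eq \<eta>'_def by (rule DERIV_cmult)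
  qed
  have cont': "continuous_on UNIV flat'"
    by (simp add: continuous_at_imp_continuous_on isCont_flat')
  have cont: "continuous_on UNIV \<eta>'"
    unfolding \<eta>'_def
    by (intro continuous_intros continuous_on_compose2[OF cont']) auto
  have zero: "eta x = 0" if "\<bar>x\<bar> \<ge> 1" for x
    using that by (simp add: eta_def eta_with_def)
  have "kernel \<rho> c (\<lambda>x. 1 / \<rho> * eta ((x - c) / \<rho>)) (\<lambda>x. 1 / \<rho> * (\<eta>' ((x - c) / \<rho>) / \<rho>))"
  proof
    fix x :: real
    have "((\<lambda>x. (x - c) / \<rho>) has_real_derivative 1 / \<rho>) (at x)"
      using assms by (auto intro!: derivative_eq_intros)
    from DERIV_chain2[OF deriv this]
    show "((\<lambda>x. 1 / \<rho> * eta ((x - c) / \<rho>)) has_real_derivative 1 / \<rho> * (\<eta>' ((x - c) / \<rho>) / \<rho>)) (at x)"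
      by (intro DERIV_cmult) simp
    show "continuous_on UNIV (\<lambda>x. 1 / \<rho> * (\<eta>' ((x - c) / \<rho>) / \<rho>))"
      using assms by (intro continuous_intros continuous_on_compose2[OF cont]) auto
    assume "\<rho> \<le> \<bar>x - c\<bar>"
    then show "1 / \<rho> * eta ((x - c) / \<rho>) = 0"
      using assms by (simp add: zero)
  qed (fact assms)+
  then show ?thesis
    by blast
qed

lemma eta_kernels:
  assumes "\<rho> > 0"
  obtains l' r' where "kernel \<rho> 0 (eta_l \<rho>) l'" "kernel \<rho> 1 (eta_r \<rho>) r'"
  using eta_kernel[OF assms, of 0] eta_kernel[OF assms, of 1]
  by (auto simp: eta_l_def[abs_def] eta_r_def[abs_def])

text \<open>Each node functional is a function of the left node plus a function of the right node.
  The iterated integral therefore separates, and each summand acquires the mass of the other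
  kernel.\<close>

lemma kernel_product_integral:
  assumes "kernel \<rho> a k k'" "kernel \<rho> b h h'" "f \<in> C0 \<rho>" "g \<in> C0 \<rho>"
    and N: "\<And>x y. x \<in> ball a \<rho> \<Longrightarrow> y \<in> ball b \<rho> \<Longrightarrow> N x y = f x + g y"
  shows "(LBINT x:ball a \<rho>. (LBINT y:ball b \<rho>. k x * h y * N x y))
       = kernel.mass \<rho> b h * integral (I_rho \<rho>) (\<lambda>x. k x * f x)
         + kernel.mass \<rho> a k * integral (I_rho \<rho>) (\<lambda>x. h x * g x)"
proof -
  interpret k: kernel \<rho> a k k' by fact
  interpret h: kernel \<rho> b h h' by fact
  let ?G = "integral (I_rho \<rho>) (\<lambda>x. h x * g x)"
  have "(LBINT y:ball b \<rho>. k x * h y * N x y) = h.mass * (k x * f x) + k x * ?G"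
    if x: "x \<in> ball a \<rho>" for x
  proof -
    have "(LBINT y:ball b \<rho>. k x * h y * N x y)
        = (LBINT y:ball b \<rho>. (k x * f x) * h y + k x * (h y * g y))"
      by (intro set_lebesgue_integral_cong) (auto simp: N[OF x] algebra_simps)
    also have "\<dots> = (LBINT y:ball b \<rho>. (k x * f x) * h y) + (LBINT y:ball b \<rho>. k x * (h y * g y))"
      using h.kernel_set_integrable' h.kernel_set_integrable[OF assms(4)]
      by (intro set_integral_add set_integrable_mult_right)
    also have "\<dots> = h.mass * (k x * f x) + k x * ?G"
      by (simp add: h.mass_def h.kernel_integral[OF assms(4)])
    finally show ?thesis .
  qed
  then have "(LBINT x:ball a \<rho>. (LBINT y:ball b \<rho>. k x * h y * N x y))
      = (LBINT x:ball a \<rho>. h.mass * (k x * f x) + ?G * k x)"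
    by (intro set_lebesgue_integral_cong) (auto simp: mult.commute)
  also have "\<dots> = (LBINT x:ball a \<rho>. h.mass * (k x * f x)) + (LBINT x:ball a \<rho>. ?G * k x)"
    using k.kernel_set_integrable' k.kernel_set_integrable[OF assms(3)]
    by (intro set_integral_add set_integrable_mult_right)
  also have "\<dots> = h.mass * integral (I_rho \<rho>) (\<lambda>x. k x * f x) + k.mass * ?G"
    by (simp add: k.mass_def k.kernel_integral[OF assms(3)])
  finally show ?thesis .
qed

text \<open>Shaped after \<open>kernel_product_integral\<close>: \<open>\<alpha>\<close> and
  \<open>\<beta>\<close> will be the two masses, \<open>w\<close> and \<open>z\<close> the weights
  for the left and right node.\<close>

lemma representable_combI:
  assumes "D \<subseteq> C0 \<rho>" "w \<in> C0 \<rho>" "z \<in> C0 \<rho>"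
    and F: "\<And>u. u \<in> D \<Longrightarrow> F u = \<alpha> * integral (I_rho \<rho>) (\<lambda>x. w x * u x)
      + \<beta> * integral (I_rho \<rho>) (\<lambda>x. z x * u x)"
  shows "representable \<rho> D F"
  unfolding representable_def
proof (intro bexI ballI)
  show "(\<lambda>x. \<alpha> * w x + \<beta> * z x) \<in> C0 \<rho>"
    using assms(2,3) by (auto simp: C0_def intro!: continuous_intros)
  fix u assume u: "u \<in> D"
  then have "(\<lambda>x. \<alpha> * (w x * u x)) integrable_on I_rho \<rho>" "(\<lambda>x. \<beta> * (z x * u x)) integrable_on I_rho \<rho>"
    using assms(1-3) unfolding I_rho_def C0_def
    by (auto intro!: integrable_continuous_real continuous_intros)
  then have "integral (I_rho \<rho>) (\<lambda>x. \<alpha> * (w x * u x) + \<beta> * (z x * u x)) = F u"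
    by (subst Henstock_Kurzweil_Integration.integral_add) (auto simp: F[OF u])
  then show "F u = integral (I_rho \<rho>) (\<lambda>x. (\<alpha> * w x + \<beta> * z x) * u x)"
    by (simp add: algebra_simps)
qed

subsection \<open>Representation of the weighted node functionals\<close>

lemma representable_wnode0:
  assumes "\<rho> > 0" "i \<in> {1..4}"
  shows "representable \<rho> (C1 \<rho>) (wnode0 \<rho> i)"
proof -
  obtain l' r' where "kernel \<rho> 0 (eta_l \<rho>) l'" "kernel \<rho> 1 (eta_r \<rho>) r'"
    by (rule eta_kernels[OF assms(1)])
  then interpret l: kernel \<rho> 0 "eta_l \<rho>" l' + r: kernel \<rho> 1 "eta_r \<rho>" r'
    by simp_all
  have wnode: "wnode0 \<rho> i u = r.mass * integral (I_rho \<rho>) (\<lambda>x. eta_l \<rho> x * f x)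
      + l.mass * integral (I_rho \<rho>) (\<lambda>x. eta_r \<rho> x * g x)"
    if "f \<in> C0 \<rho>" "g \<in> C0 \<rho>"
      "\<And>x y. x \<in> ball 0 \<rho> \<Longrightarrow> y \<in> ball 1 \<rho> \<Longrightarrow> node0 x y i u = f x + g y" for f g u
    unfolding wnode0_def B_l_def B_r_def
    by (rule kernel_product_integral[OF l.kernel_axioms r.kernel_axioms that])
  have C1: "\<exists>u'. u' \<in> C0 \<rho> \<and>
      (\<forall>x\<in>ball 0 \<rho>. deriv u x = u' x) \<and> (\<forall>x\<in>ball 1 \<rho>. deriv u x = u' x) \<and>
      integral (I_rho \<rho>) (\<lambda>x. eta_l \<rho> x * u' x) = integral (I_rho \<rho>) (\<lambda>x. - l' x * u x) \<and>
      integral (I_rho \<rho>) (\<lambda>x. eta_r \<rho> x * u' x) = integral (I_rho \<rho>) (\<lambda>x. - r' x * u x)"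
    if u: "u \<in> C1 \<rho>" for u
  proof -
    obtain u' where u': "continuous_on (I_rho \<rho>) u'"
      "\<And>x. x \<in> I_rho \<rho> \<Longrightarrow> (u has_real_derivative u' x) (at x within I_rho \<rho>)"
      using u unfolding C1_def by blast
    \<comment> \<open>\<open>deriv\<close> is the two-sided derivative, whereas \<open>C1\<close>
      gives derivatives within the interval. They coincide in the interior, which contains both open
      balls.\<close>
    have deriv: "deriv u x = u' x" if "x \<in> interior (I_rho \<rho>)" for x
    proof -
      have "x \<in> I_rho \<rho>"
        using that interior_subset by blast
      from u'(2)[OF this] have "(u has_real_derivative u' x) (at x)"
        by (simp only: at_within_interior[OF that])
      then show ?thesis
        by (rule DERIV_imp_deriv)
    qed
    show ?thesis
    proof (intro exI[of _ u'] conjI ballI)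
      show "u' \<in> C0 \<rho>"
        using u'(1) by (simp add: C0_def)
      show "deriv u x = u' x" if "x \<in> ball 0 \<rho>" for x
        using that l.ball_subset_interior by (intro deriv) blast
      show "deriv u x = u' x" if "x \<in> ball 1 \<rho>" for x
        using that r.ball_subset_interior by (intro deriv) blast
      show "integral (I_rho \<rho>) (\<lambda>x. eta_l \<rho> x * u' x) = integral (I_rho \<rho>) (\<lambda>x. - l' x * u x)"
        by (rule l.kernel_integral_deriv[OF u'])
      show "integral (I_rho \<rho>) (\<lambda>x. eta_r \<rho> x * u' x) = integral (I_rho \<rho>) (\<lambda>x. - r' x * u x)"
        by (rule r.kernel_integral_deriv[OF u'])
    qed
  qed
  from assms(2) consider "i = 1" | "i = 2" | "i = 3" | "i = 4"
    by fastforce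
  then show ?thesis
  proof cases
    case 1
    show ?thesis
    \<comment> \<open>The derivative at the left node is moved to the kernel, whence the weight
      \<open>- l'\<close>; the right node does not occur and gets weight zero.\<close>
    proof (rule representable_combI[OF C1_subset_C0 C0_minus[OF l.deriv_kernel_in_C0] C0_zero])
      fix u assume "u \<in> C1 \<rho>"
      from C1[OF this] obtain u' where u': "u' \<in> C0 \<rho>" "\<And>x. x \<in> ball 0 \<rho> \<Longrightarrow> deriv u x = u' x"
        "integral (I_rho \<rho>) (\<lambda>x. eta_l \<rho> x * u' x) = integral (I_rho \<rho>) (\<lambda>x. - l' x * u x)"
        by blast
      show "wnode0 \<rho> i u = r.mass * integral (I_rho \<rho>) (\<lambda>x. - l' x * u x)
          + l.mass * integral (I_rho \<rho>) (\<lambda>x. 0 * u x)"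
        using wnode[OF u'(1) C0_zero, of u] u'(2,3) 1 by (simp add: node0_def)
    qed
  next
    case 2
    show ?thesis
    proof (rule representable_combI[OF C1_subset_C0 C0_zero C0_minus[OF r.deriv_kernel_in_C0]])
      fix u assume "u \<in> C1 \<rho>"
      from C1[OF this] obtain u' where u': "u' \<in> C0 \<rho>" "\<And>x. x \<in> ball 1 \<rho> \<Longrightarrow> deriv u x = u' x"
        "integral (I_rho \<rho>) (\<lambda>x. eta_r \<rho> x * u' x) = integral (I_rho \<rho>) (\<lambda>x. - r' x * u x)"
        by blast
      show "wnode0 \<rho> i u = r.mass * integral (I_rho \<rho>) (\<lambda>x. 0 * u x)
          + l.mass * integral (I_rho \<rho>) (\<lambda>x. - r' x * u x)"
        using wnode[OF C0_zero u'(1), of u] u'(2,3) 2 by (simp add: node0_def)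
    qed
  next
    case 3
    show ?thesis
    proof (rule representable_combI[OF C1_subset_C0 C0_minus[OF l.kernel_in_C0] r.kernel_in_C0])
      fix u assume "u \<in> C1 \<rho>"
      then have u: "u \<in> C0 \<rho>"
        using C1_subset_C0 by blast
      show "wnode0 \<rho> i u = r.mass * integral (I_rho \<rho>) (\<lambda>x. - eta_l \<rho> x * u x)
          + l.mass * integral (I_rho \<rho>) (\<lambda>x. eta_r \<rho> x * u x)"
        using wnode[OF C0_minus[OF u] u, of u] 3 by (simp add: node0_def)
    qed
  next
    case 4
    show ?thesis
    proof (rule representable_combI[OF C1_subset_C0 l.kernel_in_C0 r.kernel_in_C0])
      fix u assume "u \<in> C1 \<rho>"
      then have u: "u \<in> C0 \<rho>"
        using C1_subset_C0 by blast
      show "wnode0 \<rho> i u = r.mass * integral (I_rho \<rho>) (\<lambda>x. eta_l \<rho> x * u x)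
          + l.mass * integral (I_rho \<rho>) (\<lambda>x. eta_r \<rho> x * u x)"
        using wnode[OF u u, of u] 4 by (simp add: node0_def)
    qed
  qed
qed

text \<open>Splits the integral between the nodes into one term for each node, as
  \<open>kernel_product_integral\<close> expects. The interval integral is oriented, so
  \<open>x\<close> and \<open>y\<close> may come in either order.\<close>

lemma interval_integral_eq_primitive:
  assumes "v \<in> C0 \<rho>" "x \<in> I_rho \<rho>" "y \<in> I_rho \<rho>"
  shows "(LBINT t=x..y. v t) = primitive \<rho> v y - primitive \<rho> v x"
proof (rule interval_integral_FTC_finite)
  have sub: "{min x y..max x y} \<subseteq> I_rho \<rho>"
    using assms by (auto simp: I_rho_def)
  then show "continuous_on {min x y..max x y} v"
    using assms(1) by (auto simp: C0_def intro: continuous_on_subset)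
  fix t assume "min x y \<le> t" "t \<le> max x y"
  then have "t \<in> I_rho \<rho>"
    using sub by auto
  then show "(primitive \<rho> v has_vector_derivative v t) (at t within {min x y..max x y})"
    unfolding has_real_derivative_iff_has_vector_derivative[symmetric]
    using primitive_derivative[OF assms(1)] sub by (blast intro: DERIV_subset)
qed

lemma representable_wnode1:
  assumes "\<rho> > 0" "i \<in> {1..3}"
  shows "representable \<rho> (C0 \<rho>) (wnode1 \<rho> i)"
proof -
  obtain l' r' where "kernel \<rho> 0 (eta_l \<rho>) l'" "kernel \<rho> 1 (eta_r \<rho>) r'"
    by (rule eta_kernels[OF assms(1)])
  then interpret l: kernel \<rho> 0 "eta_l \<rho>" l' + r: kernel \<rho> 1 "eta_r \<rho>" r'
    by simp_all
  have wnode: "wnode1 \<rho> i u = r.mass * integral (I_rho \<rho>) (\<lambda>x. eta_l \<rho> x * f x)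
      + l.mass * integral (I_rho \<rho>) (\<lambda>x. eta_r \<rho> x * g x)"
    if "f \<in> C0 \<rho>" "g \<in> C0 \<rho>"
      "\<And>x y. x \<in> ball 0 \<rho> \<Longrightarrow> y \<in> ball 1 \<rho> \<Longrightarrow> node1 x y i u = f x + g y" for f g u
    unfolding wnode1_def B_l_def B_r_def
    by (rule kernel_product_integral[OF l.kernel_axioms r.kernel_axioms that])
  from assms(2) consider "i = 1" | "i = 2" | "i = 3"
    by fastforce
  then show ?thesis
  proof cases
    case 1
    show ?thesis
    proof (rule representable_combI[OF order_refl l.kernel_in_C0 C0_zero])
      fix v assume v: "v \<in> C0 \<rho>"
      show "wnode1 \<rho> i v = r.mass * integral (I_rho \<rho>) (\<lambda>x. eta_l \<rho> x * v x)
          + l.mass * integral (I_rho \<rho>) (\<lambda>x. 0 * v x)"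
        using wnode[OF v C0_zero, of v] 1 by (simp add: node1_def)
    qed
  next
    case 2
    show ?thesis
    proof (rule representable_combI[OF order_refl C0_zero r.kernel_in_C0])
      fix v assume v: "v \<in> C0 \<rho>"
      show "wnode1 \<rho> i v = r.mass * integral (I_rho \<rho>) (\<lambda>x. 0 * v x)
          + l.mass * integral (I_rho \<rho>) (\<lambda>x. eta_r \<rho> x * v x)"
        using wnode[OF C0_zero v, of v] 2 by (simp add: node1_def)
    qed
  next
    case 3
    have diff: "(\<lambda>x. m - p x) \<in> C0 \<rho>" if "p \<in> C0 \<rho>" for m p
      using that by (auto simp: C0_def intro!: continuous_intros)
    show ?thesis
    \<comment> \<open>The constants in the two weights cancel on combination: the total weight is
      \<open>r.mass * primitive \<rho> (eta_l \<rho>) x - l.mass * primitive \<rho> (eta_r \<rho>)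
      x\<close>.\<close>
    proof (rule representable_combI[OF order_refl
          C0_minus[OF diff[OF primitive_in_C0[OF l.kernel_in_C0]]] diff[OF primitive_in_C0[OF r.kernel_in_C0]]])
      fix v assume v: "v \<in> C0 \<rho>"
      have "node1 x y i v = - primitive \<rho> v x + primitive \<rho> v y"
        if "x \<in> ball 0 \<rho>" "y \<in> ball 1 \<rho>" for x y
      proof -
        have "x \<in> I_rho \<rho>" "y \<in> I_rho \<rho>"
          using that l.ball_subset r.ball_subset by blast+
        then show ?thesis
          using 3 v by (simp add: node1_def interval_integral_eq_primitive)
      qed
      from wnode[OF C0_minus[OF primitive_in_C0[OF v]] primitive_in_C0[OF v] this]
      show "wnode1 \<rho> i v
          = r.mass * integral (I_rho \<rho>) (\<lambda>x. - (l.mass - primitive \<rho> (eta_l \<rho>) x) * v x)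
          + l.mass * integral (I_rho \<rho>) (\<lambda>x. (r.mass - primitive \<rho> (eta_r \<rho>) x) * v x)"
        unfolding mult_minus_left mult_minus_right Henstock_Kurzweil_Integration.integral_neg
        by (simp only: l.kernel_integral_primitive[OF v] r.kernel_integral_primitive[OF v])
    qed
  qed
qed

theorem theorem5p4:
  fixes \<rho> :: real
  assumes "0 < \<rho>" and "\<rho> \<le> 1 / 3"
  shows "(\<forall>i\<in>{1..4}. \<exists>!G. is_L2_extension \<rho> (C1 \<rho>) (wnode0 \<rho> i) G) \<and>
         (\<forall>i\<in>{1..3}. \<exists>!G. is_L2_extension \<rho> (C0 \<rho>) (wnode1 \<rho> i) G) \<and>
         (\<exists>C_Pi0>0. \<forall>u\<in>L2 \<rho>. Pi0 \<rho> u \<in> L2 \<rho> \<and> L2_norm \<rho> (Pi0 \<rho> u) \<le> C_Pi0 * L2_norm \<rho> u) \<and>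
         (\<exists>C_Pi1>0. \<forall>v\<in>L2 \<rho>. Pi1 \<rho> v \<in> L2 \<rho> \<and> L2_norm \<rho> (Pi1 \<rho> v) \<le> C_Pi1 * L2_norm \<rho> v)"
proof (intro conjI ballI)
  note rep0 = representable_wnode0[OF assms(1)] and rep1 = representable_wnode1[OF assms(1)]
  show "\<exists>!G. is_L2_extension \<rho> (C1 \<rho>) (wnode0 \<rho> i) G" if "i \<in> {1..4}" for i
    by (rule representable_ex1[OF order_refl C1_subset_C0 rep0[OF that]])
  show "\<exists>!G. is_L2_extension \<rho> (C0 \<rho>) (wnode1 \<rho> i) G" if "i \<in> {1..3}" for i
    by (rule representable_ex1[OF C1_subset_C0 order_refl rep1[OF that]])
  \<comment> \<open>Written as equations between functions, since the goals mention
    \<open>Pi0 \<rho> u\<close> and \<open>Pi1 \<rho> v\<close> without the argument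
    \<open>x\<close>.\<close>
  have Pi: "Pi0 \<rho> = (\<lambda>u x. \<Sum>i=1..4. L2_extension \<rho> (C1 \<rho>) (wnode0 \<rho> i) u * phi0 i x)"
    "Pi1 \<rho> = (\<lambda>v x. \<Sum>i=1..3. L2_extension \<rho> (C0 \<rho>) (wnode1 \<rho> i) v * phi1 i x)"
    by (simp_all add: fun_eq_iff Pi0_def Pi1_def)
  have phi: "phi0 i \<in> C0 \<rho>" "phi1 i \<in> C0 \<rho>" for i
    unfolding phi0_def[abs_def] phi1_def[abs_def] C0_def
    \<comment> \<open>Deciding the index first leaves a single polynomial, or the default value 0,
      in each case.\<close>
    by (cases "i = 1"; cases "i = 2"; cases "i = 3"; cases "i = 4"; force intro!: continuous_intros)+
  show "\<exists>C_Pi0>0. \<forall>u\<in>L2 \<rho>. Pi0 \<rho> u \<in> L2 \<rho> \<and> L2_norm \<rho> (Pi0 \<rho> u) \<le> C_Pi0 * L2_norm \<rho> u"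
    unfolding Pi by (rule quasi_interpolant_bounded) (use rep0 phi C1_subset_C0 in auto)
  show "\<exists>C_Pi1>0. \<forall>v\<in>L2 \<rho>. Pi1 \<rho> v \<in> L2 \<rho> \<and> L2_norm \<rho> (Pi1 \<rho> v) \<le> C_Pi1 * L2_norm \<rho> v"
    unfolding Pi by (rule quasi_interpolant_bounded) (use rep1 phi C1_subset_C0 in auto)
qed

end
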